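(* Let $\Omega$ be a Hausdorff space and let $S$ be a scoring rule that is proper on a class $\mathcal{P}$ of Borel probability measures on $\Omega$, where $|S(\mathbb{P},\mathbb{Q})|<\infty$ for all $\mathbb{P},\mathbb{Q}\in\mathcal{P}$, and such that $S(\mathbb{P},y)<0$ for all $\mathbb{P}\in\mathcal{P}$ and $y\in\Omega$. Then $$S^{\mathrm{trans}}_S(\mathbb{P},y) := \frac{S(\mathbb{P},y)}{|S(\mathbb{P},\mathbb{P})|} - \log\left(|S(\mathbb{P},\mathbb{P})|\right)$$ is also a proper scoring rule on $\mathcal{P}$. Further, if $S$ is strictly proper on $\mathcal{P}$, then so is $S^{\mathrm{trans}}_S$.
   Context: A scoring rule on a class $\mathcal{P}$ of probability measures on $\Omega$ is a function $S:\mathcal{P}\times\Omega\to[-\infty,\infty]$ such that $S(\mathbb{P},\cdot)$ is measurable for each $\mathbb{P}\in\mathcal{P}$. $S(\mathbb{P},\mathbb{Q})$ denotes the expected value of $S(\mathbb{P},Y)$ when $Y\sim\mathbb{Q}$. $S$ is proper on $\mathcal{P}$ if $S(\mathbb{Q},\mathbb{Q})\ge S(\mathbb{P},\mathbb{Q})$ for all $\mathbb{P},\mathbb{Q}\in\mathcal{P}$, and strictly proper if in addition equality holds if and only if $\mathbb{P}=\mathbb{Q}$. *)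

theory Defs
  imports "HOL-Probability.Probability"
begin

text \<open>
  The domain \<open>\<P> \<times> \<Omega>\<close> of a scoring rule is rendered by a curried total function; values at
  measures outside the class \<open>\<P>\<close> are irrelevant.  The sample space \<open>\<Omega>\<close> is the whole type.
\<close>

definition scoring_rule ::
    "'a::topological_space measure set \<Rightarrow> ('a measure \<Rightarrow> 'a \<Rightarrow> ereal) \<Rightarrow> bool" where
  "scoring_rule \<P> S \<longleftrightarrow> (\<forall>P\<in>\<P>. S P \<in> borel_measurable borel)"

text \<open>
  The expectation of an extended-real function is the difference of the integrals of its positive
  and negative parts (\<^const>\<open>e2ennreal\<close> truncates negative values to 0).  It exists iff one of the
  two is finite.  Otherwise \<open>expected_score\<close> has the junk value \<open>\<infinity> - \<infinity> = \<infinity>\<close>, so finiteness of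
  \<open>expected_score\<close> entails existence.
\<close>

definition expected_score ::
    "('a measure \<Rightarrow> 'a \<Rightarrow> ereal) \<Rightarrow> 'a measure \<Rightarrow> 'a measure \<Rightarrow> ereal" where
  "expected_score S P Q =
     enn2ereal (\<integral>\<^sup>+ y. e2ennreal (S P y) \<partial>Q) - enn2ereal (\<integral>\<^sup>+ y. e2ennreal (- S P y) \<partial>Q)"

definition expected_score_exists ::
    "('a measure \<Rightarrow> 'a \<Rightarrow> ereal) \<Rightarrow> 'a measure \<Rightarrow> 'a measure \<Rightarrow> bool" where
  "expected_score_exists S P Q \<longleftrightarrow>
     (\<integral>\<^sup>+ y. e2ennreal (S P y) \<partial>Q) < \<infinity> \<or> (\<integral>\<^sup>+ y. e2ennreal (- S P y) \<partial>Q) < \<infinity>"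

definition proper ::
    "'a measure set \<Rightarrow> ('a measure \<Rightarrow> 'a \<Rightarrow> ereal) \<Rightarrow> bool" where
  "proper \<P> S \<longleftrightarrow>
     (\<forall>P\<in>\<P>. \<forall>Q\<in>\<P>. expected_score_exists S P Q) \<and>
     (\<forall>P\<in>\<P>. \<forall>Q\<in>\<P>. expected_score S Q Q \<ge> expected_score S P Q)"

definition strictly_proper ::
    "'a measure set \<Rightarrow> ('a measure \<Rightarrow> 'a \<Rightarrow> ereal) \<Rightarrow> bool" where
  "strictly_proper \<P> S \<longleftrightarrow>
     proper \<P> S \<and>
     (\<forall>P\<in>\<P>. \<forall>Q\<in>\<P>. expected_score S Q Q = expected_score S P Q \<longleftrightarrow> P = Q)"

text \<open>
  The logarithm is taken on the reals; this is the intended value whenever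
  \<open>0 < \<bar>expected_score S P P\<bar> < \<infinity>\<close>.
\<close>

definition S_trans ::
    "('a measure \<Rightarrow> 'a \<Rightarrow> ereal) \<Rightarrow> 'a measure \<Rightarrow> 'a \<Rightarrow> ereal" where
  "S_trans S P y =
     S P y / \<bar>expected_score S P P\<bar> - ereal (ln (real_of_ereal \<bar>expected_score S P P\<bar>))"

end

theory Submission
  imports Defs
begin

text \<open>
  Write \<open>n P Q\<close> for the expected loss \<open>- S(P,Q)\<close>, a positive real number because \<open>S\<close> is negative
  with finite expectations.  Expectation is affine, so the transformed score satisfies
  \<open>S_trans(P,Q) = - n P Q / n P P - ln (n P P)\<close>, and its value at \<open>P = Q\<close> is \<open>-1 - ln (n Q Q)\<close>.
  Propriety of \<open>S\<close> is \<open>n Q Q \<le> n P Q\<close>, and then \<open>1 + ln t \<le> t\<close> at \<open>t = n Q Q / n P P\<close> gives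
  \<open>1 + ln (n Q Q) \<le> n Q Q / n P P + ln (n P P) \<le> n P Q / n P P + ln (n P P)\<close>,
  which is propriety of the transformed score.  If \<open>n Q Q < n P Q\<close>, the second inequality is
  strict; hence equality for the transformed score forces equality for \<open>S\<close>, and strictness is
  inherited (\<open>log_scaling_inequality\<close>).

  This argument uses real arithmetic, while scores are extended-real.  A negative score with finite
  expectation is almost everywhere a real-valued integrable function
  (\<open>finite_negative_expected_score\<close>), and for such scores \<^const>\<open>expected_score\<close> exists and is
  the Lebesgue integral (\<open>expected_score_eq_integral\<close>).
\<close>

text \<open>
  The score may be infinite on a null set, so agreement with a real function is only asked almost
  everywhere.
\<close>

lemma expected_score_eq_integral:
  assumes h: "integrable Q h" and eq: "AE y in Q. S P y = ereal (h y)"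
  shows "expected_score_exists S P Q" and "expected_score S P Q = ereal (integral\<^sup>L Q h)"
proof -
  have pos: "(\<integral>\<^sup>+ y. e2ennreal (S P y) \<partial>Q) = (\<integral>\<^sup>+ y. ennreal (h y) \<partial>Q)"
    using eq by (intro nn_integral_cong_AE) (auto simp: e2ennreal_ereal)
  have neg: "(\<integral>\<^sup>+ y. e2ennreal (- S P y) \<partial>Q) = (\<integral>\<^sup>+ y. ennreal (- h y) \<partial>Q)"
    using eq by (intro nn_integral_cong_AE) (auto simp: e2ennreal_ereal)
  have fin: "(\<integral>\<^sup>+ y. ennreal (h y) \<partial>Q) \<noteq> \<infinity>" "(\<integral>\<^sup>+ y. ennreal (- h y) \<partial>Q) \<noteq> \<infinity>"
    using h by (auto simp: real_integrable_def)
  show "expected_score_exists S P Q"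
    using fin pos by (simp add: expected_score_exists_def less_top)
  obtain u v where uv: "0 \<le> u" "0 \<le> v"
      "(\<integral>\<^sup>+ y. ennreal (h y) \<partial>Q) = ennreal u" "(\<integral>\<^sup>+ y. ennreal (- h y) \<partial>Q) = ennreal v"
    using fin by (metis ennreal_cases infinity_ennreal_def)
  show "expected_score S P Q = ereal (integral\<^sup>L Q h)"
    using uv by (simp add: expected_score_def pos neg real_lebesgue_integral_def[OF h])
qed

text \<open>
  For a negative score the positive part has integral 0, so finiteness of the difference bounds the
  integral of the negative part.  That excludes \<open>-\<infinity>\<close> outside a null set and gives
  integrability.  The last claim makes the rescaling in \<^const>\<open>S_trans\<close> meaningful, as it
  rules out a zero divisor and a logarithm at 0.
\<close>

lemma finite_negative_expected_score:
  assumes "prob_space Q" and "sets Q = sets borel" and "S P \<in> borel_measurable borel"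
    and neg: "\<And>y. S P y < 0" and fin: "\<bar>expected_score S P Q\<bar> < \<infinity>"
  defines "h \<equiv> \<lambda>y. real_of_ereal (S P y)"
  shows "integrable Q h" and "AE y in Q. S P y = ereal (h y)" and "integral\<^sup>L Q h < 0"
proof -
  have meas[measurable]: "S P \<in> borel_measurable Q"
    using assms(2,3) by (simp cong: measurable_cong_sets)
  have "e2ennreal (S P y) = 0" for y
    using neg[of y] by (simp add: e2ennreal_neg)
  then have nfin: "(\<integral>\<^sup>+ y. e2ennreal (- S P y) \<partial>Q) \<noteq> \<infinity>"
    using fin by (auto simp: expected_score_def zero_ennreal.rep_eq)
  have "AE y in Q. e2ennreal (- S P y) \<noteq> \<infinity>"
    by (rule nn_integral_PInf_AE) (use nfin in auto)
  then show ae: "AE y in Q. S P y = ereal (h y)"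
  proof eventually_elim
    case (elim y)
    then show ?case
      using neg[of y] by (cases "S P y") (auto simp: h_def)
  qed
  have "(\<integral>\<^sup>+ y. ennreal (norm (h y)) \<partial>Q) = (\<integral>\<^sup>+ y. e2ennreal (- S P y) \<partial>Q)"
  proof (rule nn_integral_cong_AE, use ae in eventually_elim)
    case (elim y)
    then show ?case
      using neg[of y] by (auto simp: e2ennreal_ereal)
  qed
  then show int: "integrable Q h"
    using nfin by (intro integrableI_bounded) (auto simp: h_def less_top)
  have "AE y in Q. h y < 0"
    using ae
  proof eventually_elim
    case (elim y)
    then show ?case
      using neg[of y] by (metis ereal_less(4) ereal_less_eq(5) not_le)
  qed
  then show "integral\<^sup>L Q h < 0"
    by (rule prob_space.expectation_less[OF assms(1) int])
qed

text \<open>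
  The analytic core, with \<open>x = S(P,P)\<close>, \<open>y = S(Q,Q)\<close> and \<open>z = S(P,Q)\<close>: replacing \<open>z\<close> by the larger
  value \<open>y\<close> reduces the claim to \<open>1 + ln t \<le> t\<close>.
\<close>

lemma log_scaling_inequality:
  fixes x y z :: real
  assumes "x < 0" and "y < 0" and "z \<le> y"
  shows "z / \<bar>x\<bar> - ln \<bar>x\<bar> \<le> y / \<bar>y\<bar> - ln \<bar>y\<bar>"
    and "z / \<bar>x\<bar> - ln \<bar>x\<bar> = y / \<bar>y\<bar> - ln \<bar>y\<bar> \<Longrightarrow> z = y"
proof -
  have "ln (y / x) \<le> y / x - 1"
    using assms by (intro ln_le_minus_one) (simp add: divide_neg_neg)
  moreover have "ln (y / x) = ln \<bar>y\<bar> - ln \<bar>x\<bar>"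
    using assms ln_div[of "- y" "- x"] by simp
  ultimately have *: "y / \<bar>x\<bar> - ln \<bar>x\<bar> \<le> y / \<bar>y\<bar> - ln \<bar>y\<bar>"
    using assms by simp
  moreover have "z / \<bar>x\<bar> \<le> y / \<bar>x\<bar>"
    using assms by (intro divide_right_mono) auto
  ultimately show "z / \<bar>x\<bar> - ln \<bar>x\<bar> \<le> y / \<bar>y\<bar> - ln \<bar>y\<bar>"
    by linarith
  show "z = y" if eq: "z / \<bar>x\<bar> - ln \<bar>x\<bar> = y / \<bar>y\<bar> - ln \<bar>y\<bar>"
  proof (rule ccontr)
    assume "z \<noteq> y"
    then have "z / \<bar>x\<bar> < y / \<bar>x\<bar>"
      using assms by (intro divide_strict_right_mono) auto
    then show False
      using * eq by linarith
  qed
qed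

theorem theorem5:
  fixes \<P> :: "'a::t2_space measure set"
    and S :: "'a measure \<Rightarrow> 'a \<Rightarrow> ereal"
  assumes "\<And>P. P \<in> \<P> \<Longrightarrow> prob_space P \<and> sets P = sets borel"
    and "scoring_rule \<P> S"
    and "proper \<P> S"
    and "\<And>P Q. P \<in> \<P> \<Longrightarrow> Q \<in> \<P> \<Longrightarrow> \<bar>expected_score S P Q\<bar> < \<infinity>"
    and "\<And>P y. P \<in> \<P> \<Longrightarrow> S P y < 0"
  shows "(scoring_rule \<P> (S_trans S) \<and> proper \<P> (S_trans S)) \<and>
         (strictly_proper \<P> S \<longrightarrow> strictly_proper \<P> (S_trans S))"
proof -
  define h where "h P y = real_of_ereal (S P y)" for P y
  define s where "s P Q = integral\<^sup>L Q (h P)" for P Q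
  have meas: "S P \<in> borel_measurable borel" if "P \<in> \<P>" for P
    using assms(2) that by (simp add: scoring_rule_def)
  have int: "integrable Q (h P)" and ae: "AE y in Q. S P y = ereal (h P y)" and neg: "s P Q < 0"
    if "P \<in> \<P>" "Q \<in> \<P>" for P Q
    using finite_negative_expected_score[of Q S P] assms(1,4,5) meas that
    unfolding h_def[abs_def] s_def by auto
  have score: "expected_score S P Q = ereal (s P Q)" if "P \<in> \<P>" "Q \<in> \<P>" for P Q
    unfolding s_def using int ae that by (intro expected_score_eq_integral)
  have trans_ex: "expected_score_exists (S_trans S) P Q"
    and trans_score: "expected_score (S_trans S) P Q = ereal (s P Q / \<bar>s P P\<bar> - ln \<bar>s P P\<bar>)"
    if P: "P \<in> \<P>" and Q: "Q \<in> \<P>" for P Q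
  proof -
    interpret prob_space Q
      using assms(1) Q by blast
    let ?h = "\<lambda>y. h P y / \<bar>s P P\<bar> - ln \<bar>s P P\<bar>"
    have "AE y in Q. S_trans S P y = ereal (?h y)"
      using ae[OF P Q] by eventually_elim (use neg[OF P P] in \<open>simp add: S_trans_def score P\<close>)
    moreover have "integrable Q ?h"
      using int[OF P Q] by simp
    moreover have "integral\<^sup>L Q ?h = s P Q / \<bar>s P P\<bar> - ln \<bar>s P P\<bar>"
      using int[OF P Q] by (simp add: s_def prob_space)
    ultimately show "expected_score_exists (S_trans S) P Q"
      "expected_score (S_trans S) P Q = ereal (s P Q / \<bar>s P P\<bar> - ln \<bar>s P P\<bar>)"
      using expected_score_eq_integral[of Q ?h "S_trans S" P] by simp_all
  qed
  have le: "s P Q \<le> s Q Q" if "P \<in> \<P>" "Q \<in> \<P>" for P Q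
    using assms(3) that by (auto simp: proper_def score)
  have "scoring_rule \<P> (S_trans S)"
    unfolding scoring_rule_def
  proof
    fix P assume P: "P \<in> \<P>"
    note [measurable] = meas[OF P]
    show "S_trans S P \<in> borel_measurable borel"
      unfolding S_trans_def[abs_def] by measurable
  qed
  moreover have trans_proper: "proper \<P> (S_trans S)"
    using log_scaling_inequality(1)[OF neg neg le]
    by (auto simp: proper_def trans_ex trans_score)
  moreover have "strictly_proper \<P> (S_trans S)" if strict: "strictly_proper \<P> S"
    unfolding strictly_proper_def
  proof (intro conjI ballI iffI trans_proper)
    fix P Q
    assume P: "P \<in> \<P>" and Q: "Q \<in> \<P>"
      and eq: "expected_score (S_trans S) Q Q = expected_score (S_trans S) P Q"
    have "s P Q = s Q Q"
      using log_scaling_inequality(2)[OF neg[OF P P] neg[OF Q Q] le[OF P Q]] eq P Q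
      by (simp add: trans_score)
    then show "P = Q"
      using strict P Q score unfolding strictly_proper_def by metis
  qed simp
  ultimately show ?thesis
    by blast
qed

end
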